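(* Let $G\in\mathcal{G}$ with $n$ vertices and $m$ edges, let $k\ge0$ be an integer, let $\omega^u$ be an MCP upper-bound function, and let $G'=\mathrm{core}(G,k,\omega^u)$ be the output of the peeling procedure described in the context. Then: (1) If $\omega^u$ is increasing, then $G'$ is the $(k,\omega^u)$-core of $G$. (2) The running time of the procedure is $\mathcal{O}(n+wm)$, where $w$ is the amortized time for one computation of $\omega^u$.
   Context: $\mathcal{G}$ is the class of all finite, simple, undirected graphs, and $\mathbb{N}_0=\{0,1,2,\dots\}$. $N_G(v)$ is the neighborhood of $v$, $G[S]$ the induced subgraph, $G\setminus v$ denotes vertex deletion, $H\subseteq G$ means subgraph, and $\omega(G)$ is the clique number. $\omega^u:\mathcal{G}\to\mathbb{N}_0$ is an MCP upper-bound function if $\omega(G)\le\omega^u(G)\le|V(G)|$ for every $G\in\mathcal{G}$; it is increasing if $G\subseteq G'$ implies $\omega^u(G)\le\omega^u(G')$. A $(k,\omega^u)$-core of $G=(V,E)$ is a largest (maximum number of vertices) induced subgraph $G'=G[V']$ such that $\omega^u(G'[N_{G'}(v)])\ge k$ for every $v\in V'$; when $\omega^u$ is increasing it is unique. Procedure $\mathrm{core}(G,k,\omega^u)$: set $Q_V\leftarrow V(G)$. While $Q_V\neq\emptyset$: pick and remove an (arbitrary) element $v$ of $Q_V$; if $\omega^u(G[N_G(v)])<k$ for the current graph $G$, then set $Q_V\leftarrow Q_V\cup N_G(v)$ and $G\leftarrow G\setminus v$. When $Q_V=\emptyset$, return the current graph $G$. Running-time conventions: picking and removing an element from a set takes $\mathcal{O}(1)$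 time; one computation of $\omega^u$ costs at least one elementary step ($w=\Omega(1)$); vertices that are isolated in the input graph are detected and handled separately in $\mathcal{O}(n+m)$ time without calls to $\omega^u$ (their neighborhood is empty, so the upper-bound value is $0$), and for $k=0$ no vertex is removed so no computation is needed. *)

theory Defs
  imports Complex_Main
begin

datatype 'a graph = Graph (verts: "'a set") (edges: "'a set set")

definition simple_graph :: "'a graph \<Rightarrow> bool" where
  "simple_graph G \<longleftrightarrow> finite (verts G) \<and> (\<forall>e\<in>edges G. e \<subseteq> verts G \<and> card e = 2)"

definition neighbours :: "'a graph \<Rightarrow> 'a \<Rightarrow> 'a set" where
  "neighbours G v = {u. {v, u} \<in> edges G}"

definition induced :: "'a graph \<Rightarrow> 'a set \<Rightarrow> 'a graph" where
  "induced G S = Graph (verts G \<inter> S) {e \<in> edges G. e \<subseteq> S}"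

definition delete_vertex :: "'a graph \<Rightarrow> 'a \<Rightarrow> 'a graph" where
  "delete_vertex G v = induced G (verts G - {v})"

definition subgraph :: "'a graph \<Rightarrow> 'a graph \<Rightarrow> bool" where
  "subgraph H G \<longleftrightarrow> verts H \<subseteq> verts G \<and> edges H \<subseteq> edges G"

definition clique :: "'a graph \<Rightarrow> 'a set \<Rightarrow> bool" where
  "clique G K \<longleftrightarrow> K \<subseteq> verts G \<and> (\<forall>u\<in>K. \<forall>v\<in>K. u \<noteq> v \<longrightarrow> {u, v} \<in> edges G)"

definition clique_number :: "'a graph \<Rightarrow> nat" where
  "clique_number G = Max (card ` {K. clique G K})"

definition mcp_upper_bound :: "('a graph \<Rightarrow> nat) \<Rightarrow> bool" where
  "mcp_upper_bound f \<longleftrightarrow>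
     (\<forall>G. simple_graph G \<longrightarrow> clique_number G \<le> f G \<and> f G \<le> card (verts G))"

definition increasing :: "('a graph \<Rightarrow> nat) \<Rightarrow> bool" where
  "increasing f \<longleftrightarrow>
     (\<forall>G G'. simple_graph G \<longrightarrow> simple_graph G' \<longrightarrow> subgraph G G' \<longrightarrow> f G \<le> f G')"

definition core_candidate :: "nat \<Rightarrow> ('a graph \<Rightarrow> nat) \<Rightarrow> 'a graph \<Rightarrow> 'a graph \<Rightarrow> bool" where
  "core_candidate k f G H \<longleftrightarrow>
     (\<exists>S\<subseteq>verts G. H = induced G S \<and> (\<forall>v\<in>S. f (induced H (neighbours H v)) \<ge> k))"

definition is_core :: "nat \<Rightarrow> ('a graph \<Rightarrow> nat) \<Rightarrow> 'a graph \<Rightarrow> 'a graph \<Rightarrow> bool" where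
  "is_core k f G H \<longleftrightarrow> core_candidate k f G H \<and>
     (\<forall>H'. core_candidate k f G H' \<longrightarrow> card (verts H') \<le> card (verts H))"

text \<open>The peeling procedure, as a nondeterministic transition system on pairs
  (set of vertices still to be examined, current graph). The label of a transition is the
  vertex picked by that iteration of the loop.\<close>

definition peeled :: "nat \<Rightarrow> ('a graph \<Rightarrow> nat) \<Rightarrow> 'a graph \<Rightarrow> 'a \<Rightarrow> bool" where
  "peeled k f H v \<longleftrightarrow> f (induced H (neighbours H v)) < k"

inductive peel_step ::
    "nat \<Rightarrow> ('a graph \<Rightarrow> nat) \<Rightarrow> 'a set \<times> 'a graph \<Rightarrow> 'a \<Rightarrow> 'a set \<times> 'a graph \<Rightarrow> bool"
  for k f where
  keep: "v \<in> Q \<Longrightarrow> \<not> peeled k f H v \<Longrightarrow> peel_step k f (Q, H) v (Q - {v}, H)"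
| peel: "v \<in> Q \<Longrightarrow> peeled k f H v \<Longrightarrow>
           peel_step k f (Q, H) v ((Q - {v}) \<union> neighbours H v, delete_vertex H v)"

text \<open>The trace of an execution lists, for each iteration, the current graph at its start and
  the vertex it picks.\<close>

inductive peel_run ::
    "nat \<Rightarrow> ('a graph \<Rightarrow> nat) \<Rightarrow> 'a set \<times> 'a graph \<Rightarrow> ('a graph \<times> 'a) list \<Rightarrow>
     'a set \<times> 'a graph \<Rightarrow> bool"
  for k f where
  stop: "peel_run k f s [] s"
| iter: "peel_step k f (Q, H) v s \<Longrightarrow> peel_run k f s tr s' \<Longrightarrow>
           peel_run k f (Q, H) ((H, v) # tr) s'"

definition core_run ::
    "'a graph \<Rightarrow> nat \<Rightarrow> ('a graph \<Rightarrow> nat) \<Rightarrow> ('a graph \<times> 'a) list \<Rightarrow> 'a graph \<Rightarrow> bool" where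
  "core_run G k f tr G' \<longleftrightarrow> peel_run k f (verts G, G) tr ({}, G')"

text \<open>A transition exists whenever the first component of the state is nonempty. So the
  absence of infinite executions means that every execution extends to one that returns a
  graph, whatever vertices are picked.\<close>

definition core_terminates :: "'a graph \<Rightarrow> nat \<Rightarrow> ('a graph \<Rightarrow> nat) \<Rightarrow> bool" where
  "core_terminates G k f \<longleftrightarrow>
     \<not> (\<exists>s. s 0 = (verts G, G) \<and> (\<forall>i::nat. \<exists>v. peel_step k f (s i) v (s (Suc i))))"

text \<open>Iterations of a trace that actually compute the upper-bound function: none if \<open>k = 0\<close>
  (nothing is ever peeled then), and none at vertices isolated in the input graph \<open>G\<close>
  (the value there is known to be \<open>0\<close>).\<close>

definition calls :: "'a graph \<Rightarrow> nat \<Rightarrow> ('a graph \<times> 'a) list \<Rightarrow> nat set" where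
  "calls G k tr = {i. i < length tr \<and> k \<noteq> 0 \<and> neighbours G (snd (tr ! i)) \<noteq> {}}"

text \<open>Here \<open>\<tau> i\<close> is the time of the computation of the upper-bound function in iteration \<open>i\<close>,
  in elementary steps. It may depend on the whole history, as amortized analysis allows.\<close>

definition amortized_call_time ::
    "'a graph \<Rightarrow> nat \<Rightarrow> ('a graph \<times> 'a) list \<Rightarrow> (nat \<Rightarrow> real) \<Rightarrow> real \<Rightarrow> bool" where
  "amortized_call_time G k tr \<tau> w \<longleftrightarrow>
     (\<forall>i\<in>calls G k tr. 1 \<le> \<tau> i) \<and> 1 \<le> w \<and>
     (\<Sum>i\<in>calls G k tr. \<tau> i) \<le> w * real (card (calls G k tr))"

text \<open>All remaining work, in the same unit, with one constant \<open>c\<close> bounding the cost of every primitive: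
  at most \<open>c * (n + m)\<close> for setting up the vertex set and finding the isolated vertices,
  \<open>c\<close> for picking and removing a vertex and comparing with \<open>k\<close>, and, when the vertex is
  peeled, \<open>c\<close> for it and for each of its current neighbours, to insert these into the set
  and to delete the vertex with its incident edges.\<close>

definition iteration_overhead ::
    "real \<Rightarrow> nat \<Rightarrow> ('a graph \<Rightarrow> nat) \<Rightarrow> 'a graph \<times> 'a \<Rightarrow> real" where
  "iteration_overhead c k f = (\<lambda>(H, v).
     c + (if peeled k f H v then c * (1 + real (card (neighbours H v))) else 0))"

definition running_time ::
    "real \<Rightarrow> 'a graph \<Rightarrow> nat \<Rightarrow> ('a graph \<Rightarrow> nat) \<Rightarrow> ('a graph \<times> 'a) list \<Rightarrow> (nat \<Rightarrow> real) \<Rightarrow> real" where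
  "running_time c G k f tr \<tau> =
     c * (real (card (verts G)) + real (card (edges G)))
     + (\<Sum>p\<leftarrow>tr. iteration_overhead c k f p)
     + (\<Sum>i\<in>calls G k tr. \<tau> i)"

end

theory Submission
  imports Defs
begin

text \<open>
  Correctness. Call a vertex settled if it lies in the current graph but no longer in the set
  \<open>Q\<close> of vertices to be examined. A settled vertex passed its test at some point, and deleting a
  vertex \<open>u\<close> changes the neighbourhood graphs of the neighbours of \<open>u\<close> only, all of which
  return to \<open>Q\<close>. So settled vertices keep passing the test, and once \<open>Q\<close> is empty the
  current graph is a core candidate. Conversely, a candidate contained in the current graph
  survives every deletion if \<open>\<omega>\<^sup>u\<close> is increasing: the neighbourhood graph of one of its vertices
  within the candidate is a subgraph of the one within the current graph, so the latter has a
  value of at least \<open>k\<close>. The output therefore contains all candidates and is the unique largest one.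

  Running time. The amortisation uses the potential \<open>|Q \<inter> A| + 2 m\<^sub>H\<close>, where \<open>m\<^sub>H\<close> counts the
  edges of the current graph and \<open>A\<close> is a set of vertices to be charged for. An iteration that picks
  \<open>v\<close> pays \<open>1\<close> from the removal of \<open>v\<close> from \<open>Q\<close> if \<open>v \<in> A\<close>. If \<open>v\<close> is peeled and has \<open>d\<close>
  neighbours, then \<open>Q\<close> grows by at most \<open>d\<close>, but \<open>d\<close> edges disappear, so that a further \<open>d\<close>
  is paid. With \<open>A\<close> the whole type, this bounds the iterations and the deletion work by
  \<open>n + 2 m\<close>, and in particular the procedure terminates. With \<open>A\<close> the set of vertices that are
  not isolated in the input graph, of which there are at most \<open>2 m\<close>, it bounds the calls of
  \<open>\<omega>\<^sup>u\<close> by \<open>4 m\<close>.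
\<close>

section \<open>Neighbourhoods, induced subgraphs and vertex deletion\<close>

lemma verts_induced: "verts (induced G S) = verts G \<inter> S"
  by (simp add: induced_def)

lemma edges_induced: "edges (induced G S) = {e \<in> edges G. e \<subseteq> S}"
  by (simp add: induced_def)

lemma simple_graph_induced: "simple_graph G \<Longrightarrow> simple_graph (induced G S)"
  by (auto simp: simple_graph_def induced_def)

lemma induced_induced: "induced (induced G S) T = induced G (S \<inter> T)"
  by (auto simp: induced_def)

lemma finite_edges: "simple_graph G \<Longrightarrow> finite (edges G)"
  by (rule finite_subset[of _ "Pow (verts G)"]) (auto simp: simple_graph_def)

lemma neighbours_subset: "simple_graph G \<Longrightarrow> neighbours G v \<subseteq> verts G - {v}"
  by (force simp: simple_graph_def neighbours_def)

lemma verts_delete_vertex: "verts (delete_vertex G v) = verts G - {v}"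
  by (auto simp: delete_vertex_def verts_induced)

lemma edges_delete_vertex:
  "simple_graph G \<Longrightarrow> edges (delete_vertex G v) = {e \<in> edges G. v \<notin> e}"
  by (auto simp: delete_vertex_def edges_induced simple_graph_def)

lemma incident_edges:
  assumes "simple_graph G"
  shows "{e \<in> edges G. v \<in> e} = (\<lambda>u. {v, u}) ` neighbours G v"
proof
  show "{e \<in> edges G. v \<in> e} \<subseteq> (\<lambda>u. {v, u}) ` neighbours G v"
  proof
    fix e assume "e \<in> {e \<in> edges G. v \<in> e}"
    then have e: "e \<in> edges G" "v \<in> e" and "card e = 2"
      using assms by (auto simp: simple_graph_def)
    then obtain u where "e = {v, u}"
      by (auto simp: card_2_iff)
    with e show "e \<in> (\<lambda>u. {v, u}) ` neighbours G v"
      by (auto simp: neighbours_def)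
  qed
qed (auto simp: neighbours_def)

lemma card_edges_delete_vertex:
  assumes "simple_graph G"
  shows "card (edges (delete_vertex G v)) + card (neighbours G v) = card (edges G)"
proof -
  have "inj_on (\<lambda>u. {v, u}) (neighbours G v)"
    by (auto simp: inj_on_def doubleton_eq_iff)
  then have "card {e \<in> edges G. v \<in> e} = card (neighbours G v)"
    by (simp add: incident_edges[OF assms] card_image)
  moreover have "card (edges G) = card {e \<in> edges G. v \<notin> e} + card {e \<in> edges G. v \<in> e}"
    using finite_edges[OF assms]
    by (subst card_Un_disjoint[symmetric]) (auto intro: arg_cong[where f = card])
  ultimately show ?thesis
    by (simp add: edges_delete_vertex[OF assms])
qed

text \<open>The non-isolated vertices are covered by the edges, each of which has two ends.\<close>

lemma card_non_isolated_le:
  assumes "simple_graph G"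
  shows "card {v. neighbours G v \<noteq> {}} \<le> 2 * card (edges G)"
proof -
  have "{v. neighbours G v \<noteq> {}} \<subseteq> \<Union> (edges G)"
    by (auto simp: neighbours_def)
  moreover have "finite (\<Union> (edges G))"
    by (rule finite_subset[of _ "verts G"]) (use assms in \<open>auto simp: simple_graph_def\<close>)
  ultimately have "card {v. neighbours G v \<noteq> {}} \<le> card (\<Union> (edges G))"
    by (rule card_mono[rotated])
  also have "\<dots> \<le> (\<Sum>e\<in>edges G. card e)"
    by (rule card_Union_le_sum_card)
  also have "\<dots> = (\<Sum>e\<in>edges G. 2)"
    by (rule sum.cong) (use assms in \<open>auto simp: simple_graph_def\<close>)
  finally show ?thesis by simp
qed

section \<open>The invariant of the peeling procedure\<close>

definition settled_invariant ::
    "'a graph \<Rightarrow> nat \<Rightarrow> ('a graph \<Rightarrow> nat) \<Rightarrow> 'a set \<times> 'a graph \<Rightarrow> bool" where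
  "settled_invariant G k f = (\<lambda>(Q, H).
     verts H \<subseteq> verts G \<and> induced G (verts H) = H \<and> Q \<subseteq> verts H \<and>
     (\<forall>v\<in>verts H - Q. \<not> peeled k f H v))"

lemma settled_invariant_initial:
  "simple_graph G \<Longrightarrow> settled_invariant G k f (verts G, G)"
  by (cases G) (auto simp: settled_invariant_def induced_def simple_graph_def)

lemma settled_invariant_simple:
  "simple_graph G \<Longrightarrow> settled_invariant G k f (Q, H) \<Longrightarrow> simple_graph H"
  using simple_graph_induced[of G "verts H"] by (simp add: settled_invariant_def)

text \<open>The test at \<open>v\<close> depends only on the graph induced by the neighbours of \<open>v\<close>, and this
  graph does not contain \<open>u\<close>.\<close>

lemma peeled_delete_non_neighbour:
  assumes "simple_graph H" "v \<noteq> u" "v \<notin> neighbours H u"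
  shows "peeled k f (delete_vertex H u) v \<longleftrightarrow> peeled k f H v"
proof -
  have u: "u \<notin> neighbours H v"
    using assms(3) by (simp add: neighbours_def insert_commute)
  have nb: "neighbours (delete_vertex H u) v = neighbours H v"
    using assms u by (auto simp: neighbours_def edges_delete_vertex)
  have "(verts H - {u}) \<inter> neighbours H v = neighbours H v"
    using u neighbours_subset[OF assms(1), of v] by auto
  then have "induced (delete_vertex H u) (neighbours H v) = induced H (neighbours H v)"
    by (simp add: delete_vertex_def induced_induced)
  with nb show ?thesis
    by (simp add: peeled_def)
qed

lemma settled_invariant_step:
  assumes G: "simple_graph G" and inv: "settled_invariant G k f s"
    and step: "peel_step k f s v s'"
  shows "settled_invariant G k f s'"
  using step
proof cases
  case (keep Q H)
  with inv show ?thesis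
    by (auto simp: settled_invariant_def)
next
  case (peel Q H)
  have H: "simple_graph H"
    using settled_invariant_simple[OF G] inv peel by blast
  have ind: "induced G (verts H) = H"
    using inv peel by (simp add: settled_invariant_def)
  have "delete_vertex H v = induced (induced G (verts H)) (verts H - {v})"
    using ind by (simp add: delete_vertex_def)
  also have "\<dots> = induced G (verts (delete_vertex H v))"
    by (simp add: induced_induced verts_delete_vertex Int_absorb1)
  finally have "induced G (verts (delete_vertex H v)) = delete_vertex H v" ..
  moreover have "\<not> peeled k f (delete_vertex H v) x"
    if "x \<in> verts (delete_vertex H v) - ((Q - {v}) \<union> neighbours H v)" for x
    using that inv peel(1) peeled_delete_non_neighbour[OF H, of x v]
    by (auto simp: settled_invariant_def verts_delete_vertex)
  moreover have "verts (delete_vertex H v) \<subseteq> verts G"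
    "(Q - {v}) \<union> neighbours H v \<subseteq> verts (delete_vertex H v)"
    using inv peel(1) neighbours_subset[OF H, of v]
    by (auto simp: settled_invariant_def verts_delete_vertex)
  ultimately show ?thesis
    unfolding peel(2) settled_invariant_def by blast
qed

lemma peel_run_preserves:
  assumes "peel_run k f s tr s'" "P s"
    and "\<And>s v s'. P s \<Longrightarrow> peel_step k f s v s' \<Longrightarrow> P s'"
  shows "P s'"
  using assms(1,2) by (induction rule: peel_run.induct) (simp, metis assms(3))

section \<open>The output is the core\<close>

lemma peeled_antimono:
  assumes "increasing f" "simple_graph H" "simple_graph H'" "subgraph H H'"
    and "peeled k f H' v"
  shows "peeled k f H v"
proof -
  have "subgraph (induced H (neighbours H v)) (induced H' (neighbours H' v))"
    using assms(4) by (auto simp: subgraph_def induced_def neighbours_def)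
  then have "f (induced H (neighbours H v)) \<le> f (induced H' (neighbours H' v))"
    using assms(1-3) by (simp add: increasing_def simple_graph_induced)
  with assms(5) show ?thesis
    by (simp add: peeled_def)
qed

lemma core_candidate_survives_step:
  assumes G: "simple_graph G" and f: "increasing f"
    and inv: "settled_invariant G k f s" and step: "peel_step k f s v s'"
    and K: "core_candidate k f G K" "verts K \<subseteq> verts (snd s)"
  shows "verts K \<subseteq> verts (snd s')"
  using step
proof cases
  case (keep Q H)
  with K show ?thesis by simp
next
  case (peel Q H)
  obtain S where S: "S \<subseteq> verts G" "K = induced G S" "\<And>x. x \<in> S \<Longrightarrow> \<not> peeled k f K x"
    using K(1) by (fastforce simp: core_candidate_def peeled_def)
  have H: "simple_graph H"
    using settled_invariant_simple[OF G] inv peel by blast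
  have SH: "S \<subseteq> verts H"
    using K(2) S peel by (auto simp: verts_induced)
  have "induced G (verts H) = H"
    using inv peel by (simp add: settled_invariant_def)
  then have "edges H = {e \<in> edges G. e \<subseteq> verts H}"
    by (metis edges_induced)
  then have "subgraph K H"
    using SH S(2) by (auto simp: subgraph_def verts_induced edges_induced)
  then have "peeled k f K v"
    using peeled_antimono[OF f _ H] peel simple_graph_induced[OF G] S(2) by blast
  then have "v \<notin> S"
    using S(3) by blast
  then show ?thesis
    using SH S(2) peel by (auto simp: verts_delete_vertex verts_induced)
qed

lemma core_run_is_core:
  assumes G: "simple_graph G" and f: "increasing f" and run: "core_run G k f tr G'"
  shows "is_core k f G G'" and "is_core k f G H \<Longrightarrow> H = G'"
proof -
  note run' = run[unfolded core_run_def]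
  have "settled_invariant G k f ({}, G')"
    by (rule peel_run_preserves[where P = "settled_invariant G k f", OF run'
          settled_invariant_initial[OF G] settled_invariant_step[OF G]])
  then have G': "verts G' \<subseteq> verts G" "induced G (verts G') = G'"
    and settled: "\<And>v. v \<in> verts G' \<Longrightarrow> \<not> peeled k f G' v"
    by (auto simp: settled_invariant_def)
  have candidate: "core_candidate k f G G'"
    unfolding core_candidate_def using G' settled
    by (intro exI[of _ "verts G'"]) (auto simp: peeled_def not_less)
  have sub: "verts K \<subseteq> verts G'" if K: "core_candidate k f G K" for K
  proof -
    have "verts K \<subseteq> verts G"
      using K by (auto simp: core_candidate_def verts_induced)
    then have initial:
      "settled_invariant G k f (verts G, G) \<and> verts K \<subseteq> verts (snd (verts G, G))"
      by (simp add: settled_invariant_initial[OF G])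
    have "settled_invariant G k f ({}, G') \<and> verts K \<subseteq> verts (snd ({} :: 'a set, G'))"
      by (rule peel_run_preserves[where
            P = "\<lambda>s. settled_invariant G k f s \<and> verts K \<subseteq> verts (snd s)", OF run' initial])
        (use settled_invariant_step[OF G] core_candidate_survives_step[OF G f _ _ K] in blast)
    then show ?thesis by simp
  qed
  have fin: "finite (verts G')"
    using G G'(1) by (auto simp: simple_graph_def intro: finite_subset)
  show "is_core k f G G'"
    using candidate sub fin by (auto simp: is_core_def intro: card_mono)
  show "H = G'" if H: "is_core k f G H"
  proof -
    have cand: "core_candidate k f G H"
      using H by (simp add: is_core_def)
    have "verts H = verts G'"
      using H candidate by (intro card_seteq[OF fin sub[OF cand]]) (simp add: is_core_def)
    moreover have "H = induced G (verts H)"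
      using cand by (auto simp: core_candidate_def verts_induced Int_absorb1)
    ultimately show ?thesis
      using G'(2) by simp
  qed
qed

section \<open>Amortised cost and termination\<close>

definition potential :: "'a set \<Rightarrow> 'a set \<times> 'a graph \<Rightarrow> nat" where
  "potential A = (\<lambda>(Q, H). card (Q \<inter> A) + 2 * card (edges H))"

definition charge :: "'a set \<Rightarrow> nat \<Rightarrow> ('a graph \<Rightarrow> nat) \<Rightarrow> 'a graph \<times> 'a \<Rightarrow> nat" where
  "charge A k f = (\<lambda>(H, v).
     of_bool (v \<in> A) + (if peeled k f H v then card (neighbours H v) else 0))"

text \<open>Peeling a vertex with \<open>d\<close> neighbours releases \<open>2 d\<close> from the edges. One half pays for the
  vertices inserted into \<open>Q\<close>, the other half for the deletion.\<close>

lemma charge_step: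
  assumes G: "simple_graph G" and inv: "settled_invariant G k f (Q, H)"
    and step: "peel_step k f (Q, H) v s'"
  shows "charge A k f (H, v) + potential A s' \<le> potential A (Q, H)"
proof -
  have H: "simple_graph H"
    by (rule settled_invariant_simple[OF G inv])
  have "Q \<subseteq> verts H"
    using inv by (simp add: settled_invariant_def)
  then have fin: "finite (Q \<inter> A)"
    using H by (auto simp: simple_graph_def intro: finite_subset)
  have removal: "of_bool (v \<in> A) + card ((Q - {v}) \<inter> A) = card (Q \<inter> A)" if "v \<in> Q"
  proof (cases "v \<in> A")
    case True
    have "(Q - {v}) \<inter> A = Q \<inter> A - {v}" by auto
    then show ?thesis
      using True that card_Suc_Diff1[OF fin, of v] by simp
  next
    case False
    then have "(Q - {v}) \<inter> A = Q \<inter> A" by auto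
    then show ?thesis using False by simp
  qed
  show ?thesis
    using step
  proof cases
    case keep
    then show ?thesis
      using removal by (simp add: charge_def potential_def)
  next
    case peel
    have "finite (neighbours H v)"
      using neighbours_subset[OF H, of v] H by (auto simp: simple_graph_def intro: finite_subset)
    then have "card (((Q - {v}) \<union> neighbours H v) \<inter> A)
        \<le> card (((Q - {v}) \<inter> A) \<union> neighbours H v)"
      using finite_subset[OF _ fin, of "(Q - {v}) \<inter> A"] by (intro card_mono) auto
    also have "\<dots> \<le> card ((Q - {v}) \<inter> A) + card (neighbours H v)"
      by (rule card_Un_le)
    finally show ?thesis
      using peel removal card_edges_delete_vertex[OF H, of v]
      by (simp add: charge_def potential_def)
  qed
qed

lemma charge_run:
  assumes G: "simple_graph G" and run: "peel_run k f s tr s'"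
    and inv: "settled_invariant G k f s"
  shows "(\<Sum>p\<leftarrow>tr. charge A k f p) + potential A s' \<le> potential A s"
  using run inv
proof (induction rule: peel_run.induct)
  case (iter Q H v s tr s')
  then show ?case
    using charge_step[OF G iter.prems iter.hyps(1), of A]
      settled_invariant_step[OF G iter.prems iter.hyps(1)] by simp
qed simp

lemma core_terminates_simple:
  assumes G: "simple_graph G"
  shows "core_terminates G k f"
  unfolding core_terminates_def
proof
  assume "\<exists>s. s 0 = (verts G, G) \<and> (\<forall>i::nat. \<exists>v. peel_step k f (s i) v (s (Suc i)))"
  then obtain s where s0: "s 0 = (verts G, G)"
    and step: "\<And>i::nat. \<exists>v. peel_step k f (s i) v (s (Suc i))" by auto
  have inv: "settled_invariant G k f (s i)" for i
    by (induction i)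
      (use s0 settled_invariant_initial[OF G] step settled_invariant_step[OF G]
        in \<open>auto, blast\<close>)
  have "potential UNIV (s (Suc i)) < potential UNIV (s i)" for i
  proof -
    obtain v where v: "peel_step k f (s i) v (s (Suc i))"
      using step by blast
    obtain Q H where s: "s i = (Q, H)"
      by (cases "s i")
    have "charge UNIV k f (H, v) + potential UNIV (s (Suc i)) \<le> potential UNIV (s i)"
      using charge_step[OF G, of k f Q H v] inv[of i] v s by auto
    then show ?thesis
      by (simp add: charge_def)
  qed
  then show False
    by (metis wf_no_infinite_down_chainE[OF wf_measure[of "potential UNIV"]] in_measure)
qed

section \<open>The running time\<close>

lemma card_calls_le:
  assumes G: "simple_graph G" and run: "core_run G k f tr G'"
  shows "card (calls G k tr) \<le> 4 * card (edges G)"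
proof -
  define A where "A = {v. neighbours G v \<noteq> {}}"
  have "card (calls G k tr) \<le> card {i. i < length tr \<and> snd (tr ! i) \<in> A}"
    by (intro card_mono) (auto simp: calls_def A_def)
  also have "\<dots> = length (filter (\<lambda>p. snd p \<in> A) tr)"
    by (simp add: length_filter_conv_card)
  also have "\<dots> \<le> (\<Sum>p\<leftarrow>tr. charge A k f p)"
    by (induction tr) (auto simp: charge_def)
  also have "\<dots> \<le> potential A (verts G, G)"
    using charge_run[OF G run[unfolded core_run_def] settled_invariant_initial[OF G], of A]
    by simp
  also have "\<dots> \<le> 4 * card (edges G)"
  proof -
    have "A \<subseteq> verts G"
      using G by (auto simp: A_def neighbours_def simple_graph_def)
    then show ?thesis
      using card_non_isolated_le[OF G] by (simp add: potential_def A_def Int_absorb1)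
  qed
  finally show ?thesis .
qed

lemma overhead_le:
  assumes G: "simple_graph G" and run: "core_run G k f tr G'" and c: "0 < c"
  shows "(\<Sum>p\<leftarrow>tr. iteration_overhead c k f p)
    \<le> 2 * c * (real (card (verts G)) + 2 * real (card (edges G)))"
proof -
  have "(\<Sum>p\<leftarrow>tr. charge UNIV k f p) \<le> card (verts G) + 2 * card (edges G)"
    using charge_run[OF G run[unfolded core_run_def] settled_invariant_initial[OF G], of UNIV]
    by (simp add: potential_def)
  then have total: "real (\<Sum>p\<leftarrow>tr. charge UNIV k f p)
      \<le> real (card (verts G)) + 2 * real (card (edges G))"
    by linarith
  \<comment> \<open>A peeling iteration costs \<open>c * (2 + d)\<close> against a charge of \<open>1 + d\<close>.\<close>
  have "iteration_overhead c k f p \<le> 2 * c * real (charge UNIV k f p)" for p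
    using c by (cases p) (auto simp: iteration_overhead_def charge_def algebra_simps)
  then have "(\<Sum>p\<leftarrow>tr. iteration_overhead c k f p)
      \<le> (\<Sum>p\<leftarrow>tr. 2 * c * real (charge UNIV k f p))"
    by (rule sum_list_mono)
  also have "\<dots> = 2 * c * real (\<Sum>p\<leftarrow>tr. charge UNIV k f p)"
    by (induction tr) (auto simp: algebra_simps)
  also have "\<dots> \<le> 2 * c * (real (card (verts G)) + 2 * real (card (edges G)))"
    using total c by (intro mult_left_mono) auto
  finally show ?thesis .
qed

lemma running_time_le:
  assumes G: "simple_graph G" and run: "core_run G k f tr G'" and c: "0 < c"
    and w: "amortized_call_time G k tr \<tau> w"
  shows "running_time c G k f tr \<tau>
    \<le> (5 * c + 4) * (real (card (verts G)) + w * real (card (edges G)))"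
proof -
  let ?n = "real (card (verts G))" and ?m = "real (card (edges G))"
  have "1 \<le> w"
    using w by (simp add: amortized_call_time_def)
  have "(\<Sum>i\<in>calls G k tr. \<tau> i) \<le> w * real (card (calls G k tr))"
    using w by (simp add: amortized_call_time_def)
  also have "\<dots> \<le> w * (4 * ?m)"
    using \<open>1 \<le> w\<close> card_calls_le[OF G run] by (intro mult_left_mono) auto
  finally have "running_time c G k f tr \<tau>
      \<le> c * (?n + ?m) + 2 * c * (?n + 2 * ?m) + w * (4 * ?m)"
    using overhead_le[OF G run c] by (simp add: running_time_def)
  also have "\<dots> = 3 * c * ?n + 5 * c * ?m + 4 * (w * ?m)"
    by (simp add: algebra_simps)
  \<comment> \<open>The setup and deletion work is linear in \<open>m\<close>, hence covered by \<open>w * m\<close> because \<open>w \<ge> 1\<close>.\<close>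
  also have "\<dots> \<le> (5 * c + 4) * ?n + 5 * c * (w * ?m) + 4 * (w * ?m)"
  proof -
    have "3 * c * ?n \<le> (5 * c + 4) * ?n"
      using c by (intro mult_right_mono) auto
    moreover have "5 * c * ?m \<le> 5 * c * (w * ?m)"
      using c \<open>1 \<le> w\<close> by (intro mult_left_mono) (auto simp: mult_le_cancel_right1)
    ultimately show ?thesis by linarith
  qed
  also have "\<dots> = (5 * c + 4) * (?n + w * ?m)"
    by (simp add: algebra_simps)
  finally show ?thesis .
qed

theorem proposition11:
  "(\<forall>(G :: 'a graph) k \<omega>u tr G'.
      simple_graph G \<longrightarrow> mcp_upper_bound \<omega>u \<longrightarrow> core_run G k \<omega>u tr G' \<longrightarrow> increasing \<omega>u \<longrightarrow>
      is_core k \<omega>u G G' \<and> (\<forall>H. is_core k \<omega>u G H \<longrightarrow> H = G'))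
   \<and>
   (\<forall>c>0. \<exists>C>0. \<forall>(G :: 'a graph) k \<omega>u.
      simple_graph G \<longrightarrow> mcp_upper_bound \<omega>u \<longrightarrow>
      core_terminates G k \<omega>u \<and>
      (\<forall>tr G' \<tau> w.
         core_run G k \<omega>u tr G' \<longrightarrow> amortized_call_time G k tr \<tau> w \<longrightarrow>
         running_time c G k \<omega>u tr \<tau>
           \<le> C * (real (card (verts G)) + w * real (card (edges G)))))"
proof (intro conjI allI impI)
  fix G G' H :: "'a graph" and k \<omega>u tr
  assume "simple_graph G" "core_run G k \<omega>u tr G'" "increasing \<omega>u"
  then show "is_core k \<omega>u G G'" and "is_core k \<omega>u G H \<Longrightarrow> H = G'"
    using core_run_is_core by blast+
next
  fix c :: real
  assume c: "0 < c"
  show "\<exists>C>0. \<forall>(G :: 'a graph) k \<omega>u.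
      simple_graph G \<longrightarrow> mcp_upper_bound \<omega>u \<longrightarrow>
      core_terminates G k \<omega>u \<and>
      (\<forall>tr G' \<tau> w.
         core_run G k \<omega>u tr G' \<longrightarrow> amortized_call_time G k tr \<tau> w \<longrightarrow>
         running_time c G k \<omega>u tr \<tau>
           \<le> C * (real (card (verts G)) + w * real (card (edges G))))"
    using c core_terminates_simple running_time_le[OF _ _ c]
    by (intro exI[of _ "5 * c + 4"]) auto
qed

end
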